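(* Let $V$ be a vertex set with $|V|=n\ge 2$ and let $G$ be the disjoint union of $n-1$ spanning arborescences $A_1,\dots,A_{n-1}$ on $V$. Then for every integer $k$ with $1\le k\le \lfloor n/2\rfloor$, $G$ has a rainbow arborescence with exactly $k$ arcs.
   Context: An arborescence is a connected digraph in which exactly one vertex (the root) has no incoming arc and every other vertex has exactly one incoming arc; it is spanning on $V$ if its vertex set is $V$. $G$ is the disjoint union of the arc sets $A_i$ (parallel arcs of different indices allowed). A subgraph $B$ of $G$ is rainbow if $|B\cap A_i|\le 1$ for all $i$. The arborescence in the conclusion need not be spanning. *)

theory Defs
  imports "Graph_Theory.Digraph_Component"
begin

text \<open>
  Here \<^const>\<open>Digraph_Component.connected\<close> is connectedness of the underlying undirected
  graph. The in-degree conditions are stated on \<^const>\<open>in_arcs\<close> because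
  \<^const>\<open>in_degree\<close> would be \<open>0\<close> on an infinite set of incoming arcs.
\<close>
definition arborescence :: "('a,'b) pre_digraph \<Rightarrow> bool" where
  "arborescence T \<longleftrightarrow> wf_digraph T \<and> Digraph_Component.connected T \<and>
     (\<exists>!r. r \<in> verts T \<and> in_arcs T r = {}) \<and>
     (\<forall>v \<in> verts T. in_arcs T v \<noteq> {} \<longrightarrow> card (in_arcs T v) = 1)"

text \<open>
  Arcs are abstract objects with a tail and a head, so disjointness of the arc sets still
  permits parallel arcs belonging to different arborescences.
\<close>
definition disjoint_union_of_spanning_arborescences ::
    "('a,'b) pre_digraph \<Rightarrow> 'i set \<Rightarrow> ('i \<Rightarrow> ('a,'b) pre_digraph) \<Rightarrow> bool" where
  "disjoint_union_of_spanning_arborescences G I A \<longleftrightarrow>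
     (\<forall>i \<in> I. spanning (A i) G \<and> arborescence (A i)) \<and>
     disjoint_family_on (\<lambda>i. arcs (A i)) I \<and>
     arcs G = (\<Union>i \<in> I. arcs (A i))"

definition rainbow :: "'i set \<Rightarrow> ('i \<Rightarrow> ('a,'b) pre_digraph) \<Rightarrow> ('a,'b) pre_digraph \<Rightarrow> bool" where
  "rainbow I A B \<longleftrightarrow>
     (\<forall>i \<in> I. finite (arcs B \<inter> arcs (A i)) \<and> card (arcs B \<inter> arcs (A i)) \<le> 1)"

end

theory Submission
  imports Defs
begin

text \<open>
  A rainbow arborescence \<open>B\<close> on a vertex set \<open>U\<close> with \<open>2 * card U \<le> n\<close> leaves at least
  \<open>card U\<close> colours unused. If an unused colour has its root in \<open>U\<close>, one of its arcs leaves
  \<open>U\<close> and extends \<open>B\<close>. Otherwise release the unused colours one at a time, and let \<open>S\<close> be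
  the set of roots of rainbow arborescences on \<open>U\<close> that use only the colours of \<open>B\<close> and the
  released ones. As the root of the next colour \<open>i\<close> lies outside \<open>S\<close>, some arc of \<open>A i\<close>
  enters \<open>S\<close>. If its tail is outside \<open>U\<close>, adding the arc extends the arborescence rooted at
  its head; otherwise adding it and deleting the arc into its tail makes that tail the new
  root, so \<open>S\<close> grows. Since \<open>S\<close> starts nonempty and stays inside \<open>U\<close>, it cannot grow \<open>card U\<close>
  times.
\<close>

section \<open>Arborescences with an explicit root\<close>

text \<open>Directed reachability from a named root replaces undirected connectedness, and
  injectivity of \<open>head T\<close> replaces the in-degree count: both are easy to check after
  single arcs are added or deleted. The next lemmas translate from and to
  \<open>arborescence\<close>.\<close>

definition arborescence_from :: "('a,'b) pre_digraph \<Rightarrow> 'a \<Rightarrow> bool" where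
  "arborescence_from T r \<longleftrightarrow> wf_digraph T \<and> r \<in> verts T \<and> in_arcs T r = {} \<and>
     inj_on (head T) (arcs T) \<and> (\<forall>v \<in> verts T. r \<rightarrow>\<^sup>*\<^bsub>T\<^esub> v)"

lemma reachable_crossing_arc:
  assumes "u \<rightarrow>\<^sup>*\<^bsub>T\<^esub> v" "u \<in> X" "v \<notin> X"
  obtains e where "e \<in> arcs T" "tail T e \<in> X" "head T e \<notin> X"
proof -
  have "v \<in> X \<or> (\<exists>e \<in> arcs T. tail T e \<in> X \<and> head T e \<notin> X)"
    using assms(1) unfolding reachable_def
    by (induction rule: rtrancl_on_induct) (use assms(2) in \<open>auto simp: arcs_ends_conv\<close>)
  then show thesis using assms(3) that by blast
qed

text \<open>The set \<open>X\<close> of vertices reachable from the root is closed under following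
  arcs forwards, and also backwards because entering arcs are unique. So no edge of the underlying
  undirected graph leaves \<open>X\<close>, and connectedness makes \<open>X\<close> contain every
  vertex.\<close>

lemma arborescence_imp_arborescence_from:
  assumes "arborescence T"
  obtains r where "arborescence_from T r"
proof -
  interpret wf_digraph T using assms by (simp add: arborescence_def)
  from assms obtain r where r: "r \<in> verts T" "in_arcs T r = {}"
    unfolding arborescence_def by blast
  have one: "e = f" if "e \<in> arcs T" "f \<in> arcs T" "head T e = head T f" for e f
  proof -
    have in_arcs: "e \<in> in_arcs T (head T e)" "f \<in> in_arcs T (head T e)"
      using that by (simp_all add: in_arcs_def)
    moreover have "head T e \<in> verts T" using that by simp
    ultimately have "card (in_arcs T (head T e)) = 1"
      using assms unfolding arborescence_def by blast
    then obtain g where "in_arcs T (head T e) = {g}" by (rule card_1_singletonE)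
    with in_arcs show ?thesis by (metis singletonD)
  qed
  define X where "X = {v. r \<rightarrow>\<^sup>*\<^bsub>T\<^esub> v}"
  have X_pred: "tail T e \<in> X" if e: "e \<in> arcs T" "head T e \<in> X" for e
  proof -
    have "r \<rightarrow>\<^sup>*\<^bsub>T\<^esub> head T e" using e by (simp add: X_def)
    \<comment> \<open>No arc enters \<open>r\<close>, so a walk from \<open>r\<close> to
      \<open>head T e\<close> is nontrivial and has a last arc, which must be \<open>e\<close> by
      uniqueness.\<close>
    moreover have "r \<noteq> head T e" using e r by (auto simp: in_arcs_def)
    ultimately obtain w where "r \<rightarrow>\<^sup>*\<^bsub>T\<^esub> w" "w \<rightarrow>\<^bsub>T\<^esub> head T e"
      unfolding reachable_def by (cases rule: rtrancl_on.cases) auto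
    then obtain f where "f \<in> arcs T" "tail T f = w" "head T f = head T e"
      by (auto simp: arcs_ends_conv)
    moreover from this one e(1) have "f = e" by metis
    ultimately show ?thesis using \<open>r \<rightarrow>\<^sup>*\<^bsub>T\<^esub> w\<close> by (simp add: X_def)
  qed
  have X_succ: "head T e \<in> X" if "e \<in> arcs T" "tail T e \<in> X" for e
    using that by (auto simp: X_def intro: reachable_adj_trans in_arcs_imp_in_arcs_ends)
  have "v \<in> X" if "v \<in> verts T" for v
  proof (rule ccontr)
    assume "v \<notin> X"
    have "r \<in> X" using r by (simp add: X_def)
    have "r \<rightarrow>\<^sup>*\<^bsub>with_proj (mk_symmetric T)\<^esub> v"
      using assms r(1) that by (simp add: arborescence_def connected_def strongly_connected_def)
    then obtain p where "p \<in> parcs (mk_symmetric T)" "fst p \<in> X" "snd p \<notin> X"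
      by (rule reachable_crossing_arc[OF _ \<open>r \<in> X\<close> \<open>v \<notin> X\<close>]) simp
    then obtain e where "e \<in> arcs T" "p = (tail T e, head T e) \<or> p = (head T e, tail T e)"
      unfolding parcs_mk_symmetric by blast
    with X_pred[of e] X_succ[of e] \<open>fst p \<in> X\<close> \<open>snd p \<notin> X\<close> show False by (elim disjE) simp_all
  qed
  then have "arborescence_from T r"
    using r one wf_digraph_axioms by (auto simp: arborescence_from_def X_def inj_on_def)
  then show thesis by (rule that)
qed

text \<open>Together with injectivity of \<open>head T\<close>, this matches arcs with non-root
  vertices. It yields the uniqueness of the root, the arc count and the finiteness of the arc
  set.\<close>

lemma arborescence_from_heads:
  assumes "arborescence_from T r"
  shows "head T ` arcs T = verts T - {r}"
proof
  interpret wf_digraph T using assms by (simp add: arborescence_from_def)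
  show "head T ` arcs T \<subseteq> verts T - {r}"
    using assms by (auto simp: arborescence_from_def in_arcs_def)
  show "verts T - {r} \<subseteq> head T ` arcs T"
  proof
    fix v assume v: "v \<in> verts T - {r}"
    then have "r \<rightarrow>\<^sup>*\<^bsub>T\<^esub> v" "r \<noteq> v" using assms by (auto simp: arborescence_from_def)
    then obtain w where "w \<rightarrow>\<^bsub>T\<^esub> v"
      unfolding reachable_def by (cases rule: rtrancl_on.cases) auto
    then show "v \<in> head T ` arcs T" by (auto simp: arcs_ends_conv)
  qed
qed

text \<open>In the symmetric closure any two vertices are joined through \<open>r\<close>.\<close>

lemma arborescence_from_imp_arborescence:
  assumes "arborescence_from T r"
  shows "arborescence T"
proof -
  interpret wf_digraph T using assms by (simp add: arborescence_from_def)
  interpret S: pair_wf_digraph "mk_symmetric T" ..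
  have reach: "r \<rightarrow>\<^sup>*\<^bsub>with_proj (mk_symmetric T)\<^esub> v" if "v \<in> verts T" for v
    using assms that by (auto simp: arborescence_from_def intro: reachable_mk_symmetricI)
  have "connected T"
    unfolding connected_def
  proof (rule strongly_connectedI)
    show "verts (with_proj (mk_symmetric T)) \<noteq> {}"
      using assms by (auto simp: arborescence_from_def)
    fix u v assume "u \<in> verts (with_proj (mk_symmetric T))" "v \<in> verts (with_proj (mk_symmetric T))"
    then have "r \<rightarrow>\<^sup>*\<^bsub>with_proj (mk_symmetric T)\<^esub> u" "r \<rightarrow>\<^sup>*\<^bsub>with_proj (mk_symmetric T)\<^esub> v"
      using reach by simp_all
    then show "u \<rightarrow>\<^sup>*\<^bsub>with_proj (mk_symmetric T)\<^esub> v"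
      by (blast intro: S.reachable_trans symmetric_reachable[OF symmetric_mk_symmetric])
  qed
  moreover have "\<exists>!s. s \<in> verts T \<and> in_arcs T s = {}"
  proof (intro ex1I)
    show "r \<in> verts T \<and> in_arcs T r = {}" using assms by (simp add: arborescence_from_def)
    fix s assume s: "s \<in> verts T \<and> in_arcs T s = {}"
    then have "s \<notin> head T ` arcs T" by (auto simp: in_arcs_def)
    with s show "s = r" unfolding arborescence_from_heads[OF assms] by blast
  qed
  moreover have "card (in_arcs T v) = 1" if "in_arcs T v \<noteq> {}" for v
  proof -
    from that obtain e where "e \<in> arcs T" "head T e = v" by (auto simp: in_arcs_def)
    with assms have "in_arcs T v = {e}" by (auto simp: arborescence_from_def in_arcs_def inj_on_def)
    then show ?thesis by simp
  qed
  ultimately show ?thesis using wf_digraph_axioms by (simp add: arborescence_def)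
qed

lemma card_arcs_arborescence_from:
  assumes "arborescence_from T r" "finite (verts T)"
  shows "Suc (card (arcs T)) = card (verts T)"
proof -
  have "card (arcs T) = card (verts T - {r})"
    using arborescence_from_heads[OF assms(1)] assms(1)
    by (metis arborescence_from_def card_image)
  moreover have "r \<in> verts T" using assms(1) by (simp add: arborescence_from_def)
  ultimately show ?thesis using assms(2) by (metis card.remove)
qed

section \<open>Extending and rerooting an arborescence inside a digraph\<close>

context wf_digraph
begin

lemma subgraph_restrictI:
  assumes "U \<subseteq> verts G" "F \<subseteq> arcs G" "tail G ` F \<subseteq> U" "head G ` F \<subseteq> U"
  shows "subgraph (G\<lparr>verts := U, arcs := F\<rparr>) G"
proof -
  have "wf_digraph (G\<lparr>verts := U, arcs := F\<rparr>)"
    using assms by unfold_locales auto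
  then show ?thesis
    using assms wf_digraph_axioms by (auto simp: subgraph_def compatible_def)
qed

text \<open>Old walks from \<open>r\<close> survive in the larger digraph, and \<open>e\<close>
  prolongs the one to its tail. Its head is a new vertex, so heads stay distinct.\<close>

lemma arborescence_from_insert_leaf:
  assumes B: "arborescence_from B r" "subgraph B G"
    and e: "e \<in> arcs G" "tail G e \<in> verts B" "head G e \<notin> verts B"
  defines "B' \<equiv> G\<lparr>verts := insert (head G e) (verts B), arcs := insert e (arcs B)\<rparr>"
  shows "arborescence_from B' r" "subgraph B' G"
proof -
  interpret B: wf_digraph B using B by (simp add: arborescence_from_def)
  have ht: "tail B = tail G" "head B = head G"
    using B(2) by (auto simp: subgraph_def compatible_def)
  have mem: "\<And>f. f \<in> arcs B \<Longrightarrow> head G f \<in> verts B \<and> tail G f \<in> verts B"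
    using B.wellformed ht by auto
  show sub: "subgraph B' G"
    unfolding B'_def
    by (rule subgraph_restrictI) (use B e mem in \<open>auto simp: subgraph_def\<close>)
  then interpret B': wf_digraph B' by (simp add: subgraph_def)
  have "subgraph B B'"
    using sub B unfolding subgraph_def compatible_def B'_def by auto
  then have old: "r \<rightarrow>\<^sup>*\<^bsub>B'\<^esub> v" if "v \<in> verts B" for v
    using B(1) B'.reachable_mono that by (auto simp: arborescence_from_def)
  have "tail G e \<rightarrow>\<^bsub>B'\<^esub> head G e" by (auto simp: B'_def arcs_ends_conv)
  with old e have "r \<rightarrow>\<^sup>*\<^bsub>B'\<^esub> head G e" by (meson B'.reachable_adj_trans)
  with old have "\<forall>v \<in> verts B'. r \<rightarrow>\<^sup>*\<^bsub>B'\<^esub> v" by (auto simp: B'_def)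
  moreover have "inj_on (head B') (arcs B')"
    using B(1) e mem by (auto simp: arborescence_from_def B'_def ht)
  moreover have "in_arcs B' r = {}" "r \<in> verts B'"
    using B(1) e(3) by (auto simp: arborescence_from_def B'_def in_arcs_def ht)
  ultimately show "arborescence_from B' r"
    using B'.wf_digraph_axioms by (simp add: arborescence_from_def)
qed

text \<open>The arc \<open>e\<close> enters the old root, which no arc of \<open>B\<close> enters,
  so heads stay distinct; prefixing \<open>e\<close> to the old walks from \<open>r\<close> reaches
  every old vertex.\<close>

lemma arborescence_from_insert_root:
  assumes B: "arborescence_from B r" "subgraph B G"
    and e: "e \<in> arcs G" "tail G e \<notin> verts B" "head G e = r"
  defines "B' \<equiv> G\<lparr>verts := insert (tail G e) (verts B), arcs := insert e (arcs B)\<rparr>"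
  shows "arborescence_from B' (tail G e)" "subgraph B' G"
proof -
  interpret B: wf_digraph B using B by (simp add: arborescence_from_def)
  have ht: "tail B = tail G" "head B = head G"
    using B(2) by (auto simp: subgraph_def compatible_def)
  have mem: "\<And>f. f \<in> arcs B \<Longrightarrow> head G f \<in> verts B \<and> tail G f \<in> verts B"
    using B.wellformed ht by auto
  have r: "r \<in> verts B" "\<And>f. f \<in> arcs B \<Longrightarrow> head G f \<noteq> r"
    using B(1) by (auto simp: arborescence_from_def in_arcs_def ht)
  show sub: "subgraph B' G"
    unfolding B'_def
    by (rule subgraph_restrictI) (use B e mem r in \<open>auto simp: subgraph_def\<close>)
  then interpret B': wf_digraph B' by (simp add: subgraph_def)
  have "subgraph B B'"
    using sub B unfolding subgraph_def compatible_def B'_def by auto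
  then have old: "r \<rightarrow>\<^sup>*\<^bsub>B'\<^esub> v" if "v \<in> verts B" for v
    using B(1) B'.reachable_mono that by (auto simp: arborescence_from_def)
  have "tail G e \<rightarrow>\<^bsub>B'\<^esub> r" using e by (auto simp: B'_def arcs_ends_conv)
  with old have "tail G e \<rightarrow>\<^sup>*\<^bsub>B'\<^esub> v" if "v \<in> verts B" for v
    using that by (meson B'.adj_reachable_trans)
  moreover have "tail G e \<rightarrow>\<^sup>*\<^bsub>B'\<^esub> tail G e" by (rule B'.reachable_refl) (simp add: B'_def)
  ultimately have "\<forall>v \<in> verts B'. tail G e \<rightarrow>\<^sup>*\<^bsub>B'\<^esub> v" by (auto simp: B'_def)
  moreover have "inj_on (head B') (arcs B')"
    using B(1) e r by (auto simp: arborescence_from_def B'_def ht)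
  moreover have "in_arcs B' (tail G e) = {}" "tail G e \<in> verts B'"
    using e(2,3) r mem unfolding B'_def in_arcs_def by (simp_all, metis)
  ultimately show "arborescence_from B' (tail G e)"
    using B'.wf_digraph_axioms by (simp add: arborescence_from_def)
qed

text \<open>Adding \<open>e\<close> closes a directed cycle through \<open>r\<close> and
  \<open>tail G e\<close>; deleting the arc into \<open>tail G e\<close> breaks it. The assumption
  \<open>tail G e \<noteq> r\<close> excludes a loop, which would itself enter the new root.\<close>

lemma arborescence_from_swap_root:
  assumes B: "arborescence_from B r" "subgraph B G"
    and e: "e \<in> arcs G" "tail G e \<in> verts B" "head G e = r" "tail G e \<noteq> r"
  defines "B' \<equiv> G\<lparr>verts := verts B, arcs := insert e {f \<in> arcs B. head G f \<noteq> tail G e}\<rparr>"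
  shows "arborescence_from B' (tail G e)" "subgraph B' G"
proof -
  interpret B: wf_digraph B using B by (simp add: arborescence_from_def)
  have ht: "tail B = tail G" "head B = head G"
    using B(2) by (auto simp: subgraph_def compatible_def)
  have mem: "\<And>f. f \<in> arcs B \<Longrightarrow> head G f \<in> verts B \<and> tail G f \<in> verts B"
    using B.wellformed ht by auto
  have r: "r \<in> verts B" "\<And>f. f \<in> arcs B \<Longrightarrow> head G f \<noteq> r"
    using B(1) by (auto simp: arborescence_from_def in_arcs_def ht)
  show sub: "subgraph B' G"
    unfolding B'_def
    by (rule subgraph_restrictI) (use B e mem r in \<open>auto simp: subgraph_def\<close>)
  then interpret B': wf_digraph B' by (simp add: subgraph_def)
  have base: "tail G e \<rightarrow>\<^sup>*\<^bsub>B'\<^esub> tail G e"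
    by (rule B'.reachable_refl) (use e in \<open>simp add: B'_def\<close>)
  have "tail G e \<rightarrow>\<^bsub>B'\<^esub> r" using e by (auto simp: B'_def arcs_ends_conv)
  then have root: "tail G e \<rightarrow>\<^sup>*\<^bsub>B'\<^esub> r" by (rule B'.reachable_adjI)
  have "tail G e \<rightarrow>\<^sup>*\<^bsub>B'\<^esub> v" if "r \<rightarrow>\<^sup>*\<^bsub>B\<^esub> v" for v
    using that unfolding reachable_def[of B]
  proof (induction rule: rtrancl_on_induct)
    case base
    show ?case by (rule root)
  next
    case (step y z)
    then obtain f where f: "f \<in> arcs B" "tail G f = y" "head G f = z"
      by (auto simp: arcs_ends_conv ht)
    show ?case
    \<comment> \<open>The only arc of a walk in \<open>B\<close> that may be missing from
      \<open>B'\<close> is the one into \<open>tail G e\<close>; there the walk restarts at the new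
      root.\<close>
    proof (cases "z = tail G e")
      case True
      then show ?thesis using base by simp
    next
      case False
      with f have "y \<rightarrow>\<^bsub>B'\<^esub> z" by (auto simp: B'_def arcs_ends_conv)
      with step.IH show ?thesis by (rule B'.reachable_adj_trans)
    qed
  qed
  then have "\<forall>v \<in> verts B'. tail G e \<rightarrow>\<^sup>*\<^bsub>B'\<^esub> v"
    using B(1) by (auto simp: B'_def arborescence_from_def)
  moreover have "inj_on (head B') (arcs B')"
    using B(1) e r by (auto simp: arborescence_from_def B'_def ht inj_on_def)
  moreover have "in_arcs B' (tail G e) = {}" "tail G e \<in> verts B'"
    using e r mem by (auto simp: B'_def in_arcs_def)
  ultimately show "arborescence_from B' (tail G e)"
    using B'.wf_digraph_axioms by (simp add: arborescence_from_def)
qed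

end

section \<open>Rainbow arborescences in a packing of spanning arborescences\<close>

locale arborescence_packing = wf_digraph G for G :: "('a,'b) pre_digraph" +
  fixes I :: "'i set" and A :: "'i \<Rightarrow> ('a,'b) pre_digraph" and root :: "'i \<Rightarrow> 'a"
    and col :: "'b \<Rightarrow> 'i"
  assumes finite_verts: "finite (verts G)" and finite_I: "finite I"
    and spanning_A: "i \<in> I \<Longrightarrow> spanning (A i) G"
    and rooted_A: "i \<in> I \<Longrightarrow> arborescence_from (A i) (root i)"
    and col_A: "\<lbrakk>i \<in> I; e \<in> arcs (A i)\<rbrakk> \<Longrightarrow> col e = i"
begin

text \<open>The rainbow condition is stated as injectivity of \<open>col\<close>, so that a new arc
  only has to bring a fresh colour.\<close>

definition rainbow_from :: "('a,'b) pre_digraph \<Rightarrow> 'a \<Rightarrow> bool" where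
  "rainbow_from B r \<longleftrightarrow> subgraph B G \<and> arborescence_from B r \<and> inj_on col (arcs B)"

text \<open>\<open>A i\<close> is spanning, so its root reaches \<open>v\<close> and the walk must
  leave \<open>X\<close>. Taking a complement for \<open>X\<close> gives arcs that enter a
  set.\<close>

lemma crossing_arc:
  assumes "i \<in> I" "root i \<in> X" "v \<in> verts G" "v \<notin> X"
  obtains e where "e \<in> arcs G" "col e = i" "tail G e \<in> X" "head G e \<notin> X"
proof -
  have sub: "verts (A i) = verts G" "arcs (A i) \<subseteq> arcs G" "tail (A i) = tail G" "head (A i) = head G"
    using spanning_A[OF assms(1)] by (auto simp: spanning_def subgraph_def compatible_def)
  have "root i \<rightarrow>\<^sup>*\<^bsub>A i\<^esub> v"
    using rooted_A[OF assms(1)] assms(3) sub by (simp add: arborescence_from_def)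
  then obtain e where "e \<in> arcs (A i)" "tail (A i) e \<in> X" "head (A i) e \<notin> X"
    using assms(2,4) by (rule reachable_crossing_arc)
  then show thesis using that[of e] sub col_A[OF assms(1), of e] by auto
qed

lemma finite_arcs_rainbow_from:
  assumes "rainbow_from B r"
  shows "finite (verts B)" "finite (arcs B)"
proof -
  show *: "finite (verts B)"
    using assms finite_verts finite_subset by (auto simp: rainbow_from_def subgraph_def)
  have "finite (head B ` arcs B)"
    using arborescence_from_heads[of B r] * assms by (simp add: rainbow_from_def)
  then show "finite (arcs B)"
    using assms finite_imageD by (auto simp: rainbow_from_def arborescence_from_def)
qed

lemma rainbow_from_insert_leaf:
  assumes B: "rainbow_from B r"
    and e: "e \<in> arcs G" "tail G e \<in> verts B" "head G e \<notin> verts B" "col e \<notin> col ` arcs B"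
  shows "\<exists>B'. rainbow_from B' r \<and> card (verts B') = Suc (card (verts B))"
proof -
  let ?B' = "G\<lparr>verts := insert (head G e) (verts B), arcs := insert e (arcs B)\<rparr>"
  have "rainbow_from ?B' r"
    using arborescence_from_insert_leaf[of B r e] B e by (auto simp: rainbow_from_def)
  moreover have "card (verts ?B') = Suc (card (verts B))"
    using finite_arcs_rainbow_from[OF B] e by simp
  ultimately show ?thesis by blast
qed

lemma rainbow_from_insert_root:
  assumes B: "rainbow_from B r"
    and e: "e \<in> arcs G" "tail G e \<notin> verts B" "head G e = r" "col e \<notin> col ` arcs B"
  shows "\<exists>B'. rainbow_from B' (tail G e) \<and> card (verts B') = Suc (card (verts B))"
proof -
  let ?B' = "G\<lparr>verts := insert (tail G e) (verts B), arcs := insert e (arcs B)\<rparr>"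
  have "rainbow_from ?B' (tail G e)"
    using arborescence_from_insert_root[of B r e] B e by (auto simp: rainbow_from_def)
  moreover have "card (verts ?B') = Suc (card (verts B))"
    using finite_arcs_rainbow_from[OF B] e by simp
  ultimately show ?thesis by blast
qed

text \<open>Only an upper bound on the new colours is recorded, as the colour of a deleted arc drops
  out.\<close>

lemma rainbow_from_swap_root:
  assumes B: "rainbow_from B r"
    and e: "e \<in> arcs G" "tail G e \<in> verts B" "head G e = r" "tail G e \<noteq> r" "col e \<notin> col ` arcs B"
  shows "\<exists>B'. rainbow_from B' (tail G e) \<and> verts B' = verts B \<and>
    col ` arcs B' \<subseteq> insert (col e) (col ` arcs B)"
proof -
  let ?B' = "G\<lparr>verts := verts B, arcs := insert e {f \<in> arcs B. head G f \<noteq> tail G e}\<rparr>"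
  have "inj_on col {f \<in> arcs B. head G f \<noteq> tail G e}"
    using B unfolding rainbow_from_def by (blast intro: inj_on_subset)
  then have "inj_on col (arcs ?B')" using e(5) by auto
  then have "rainbow_from ?B' (tail G e)"
    using arborescence_from_swap_root[of B r e] B e(1-4) by (simp add: rainbow_from_def)
  then show ?thesis by (intro exI[of _ ?B']) auto
qed

section \<open>Rerooting on a fixed vertex set and counting roots\<close>

text \<open>This is the set \<open>S\<close> of the opening comment, with \<open>J\<close> the
  allowed colours. Different roots may be witnessed by different arborescences, which share only the
  vertex set \<open>U\<close>.\<close>

definition reroots :: "'a set \<Rightarrow> 'i set \<Rightarrow> 'a set" where
  "reroots U J = {r. \<exists>B. rainbow_from B r \<and> verts B = U \<and> col ` arcs B \<subseteq> J}"

lemma reroots_subset: "reroots U J \<subseteq> U"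
  by (auto simp: reroots_def rainbow_from_def arborescence_from_def)

lemma reroots_grow:
  assumes maximal: "\<nexists>B r. rainbow_from B r \<and> card (verts B) = Suc (card U)"
    and i: "i \<in> I" "i \<notin> J" "root i \<notin> U" and nonempty: "reroots U J \<noteq> {}"
  shows "reroots U J \<subset> reroots U (insert i J)"
proof
  show "reroots U J \<subseteq> reroots U (insert i J)" unfolding reroots_def by blast
  from nonempty obtain v where v: "v \<in> reroots U J" by blast
  then have "v \<in> verts G" by (auto simp: reroots_def rainbow_from_def arborescence_from_def subgraph_def)
  then obtain e where e: "e \<in> arcs G" "col e = i" "tail G e \<notin> reroots U J" "head G e \<in> reroots U J"
    using crossing_arc[OF i(1), of "- reroots U J" v] i(3) v reroots_subset[of U J] by blast
  then obtain B where B: "rainbow_from B (head G e)" "verts B = U" "col ` arcs B \<subseteq> J"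
    by (auto simp: reroots_def)
  have fresh: "col e \<notin> col ` arcs B" using B e i by auto
  \<comment> \<open>A tail outside \<open>U\<close> would become a new root above \<open>B\<close>
    and contradict \<open>maximal\<close>.\<close>
  have "tail G e \<in> verts B"
    using rainbow_from_insert_root[OF B(1) e(1) _ refl fresh] maximal B(2) by blast
  moreover have "tail G e \<noteq> head G e" using e by metis
  ultimately obtain B' where "rainbow_from B' (tail G e)" "verts B' = U"
      "col ` arcs B' \<subseteq> insert i (col ` arcs B)"
    using rainbow_from_swap_root[OF B(1) e(1) _ refl _ fresh] B e by auto
  then have "tail G e \<in> reroots U (insert i J)" using B unfolding reroots_def by blast
  with e(3) show "reroots U J \<noteq> reroots U (insert i J)" by blast
qed

lemma rainbow_from_extend:
  assumes B: "rainbow_from B r"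
    and proper: "verts B \<noteq> verts G"
    and many: "card (verts B) \<le> card (I - col ` arcs B)"
  shows "\<exists>B' r'. rainbow_from B' r' \<and> card (verts B') = Suc (card (verts B))"
proof (rule ccontr)
  assume maximal: "\<not> ?thesis"
  let ?U = "verts B" and ?J = "col ` arcs B"
  have U: "finite ?U" "?U \<subseteq> verts G"
    using finite_arcs_rainbow_from[OF B] B by (auto simp: rainbow_from_def subgraph_def)
  have outside: "root i \<notin> ?U" if i: "i \<in> I - ?J" for i
  proof
    assume "root i \<in> ?U"
    moreover from proper U obtain v where "v \<in> verts G" "v \<notin> ?U" by blast
    ultimately obtain e where "e \<in> arcs G" "col e = i" "tail G e \<in> ?U" "head G e \<notin> ?U"
      using crossing_arc i by blast
    then show False using rainbow_from_insert_leaf[OF B] maximal i by blast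
  qed
  \<comment> \<open>\<open>B\<close> itself is a witness whatever colours are released, so the
    nonemptiness required by \<open>reroots_grow\<close> always holds.\<close>
  have start: "r \<in> reroots ?U (?J \<union> D)" for D
    using B by (auto simp: reroots_def)
  have "card D < card (reroots ?U (?J \<union> D))" if "finite D" "D \<subseteq> I - ?J" for D
    using that
  proof (induction rule: finite_induct)
    case empty
    then show ?case
      using start[of "{}"] finite_subset[OF reroots_subset U(1)] by (auto simp: card_gt_0_iff)
  next
    case (insert i D)
    have "reroots ?U (?J \<union> D) \<subset> reroots ?U (insert i (?J \<union> D))"
      using insert outside start maximal by (intro reroots_grow) auto
    then have "card (reroots ?U (?J \<union> D)) < card (reroots ?U (?J \<union> insert i D))"
      using finite_subset[OF reroots_subset U(1)] by (simp add: psubset_card_mono)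
    with insert show ?case by simp
  qed
  from this[of "I - ?J"] have "card (I - ?J) < card (reroots ?U (?J \<union> (I - ?J)))"
    using finite_I by simp
  also have "\<dots> \<le> card ?U" using U(1) reroots_subset by (rule card_mono)
  finally show False using many by simp
qed

text \<open>Induction on the number \<open>k\<close> of arcs, starting from a single vertex and
  extending by one vertex at a time.\<close>

lemma rainbow_from_exists:
  assumes "verts G \<noteq> {}" "2 * k \<le> card (verts G)" "card (verts G) \<le> Suc (card I)"
  shows "\<exists>B r. rainbow_from B r \<and> card (verts B) = Suc k"
  using assms(2)
proof (induction k)
  case 0
  from assms(1) obtain r where "r \<in> verts G" by blast
  let ?B = "G\<lparr>verts := {r}, arcs := {}\<rparr>"
  have sub: "subgraph ?B G" using \<open>r \<in> verts G\<close> by (intro subgraph_restrictI) auto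
  then interpret B: wf_digraph ?B by (simp add: subgraph_def)
  have "rainbow_from ?B r"
    using sub B.wf_digraph_axioms
    by (auto simp: rainbow_from_def arborescence_from_def in_arcs_def)
  then show ?case by (intro exI[of _ ?B]) auto
next
  case (Suc k)
  then obtain B r where B: "rainbow_from B r" and card: "card (verts B) = Suc k" by auto
  have arcs: "card (arcs B) = k"
    using card_arcs_arborescence_from[of B r] B card finite_arcs_rainbow_from[OF B]
    by (simp add: rainbow_from_def)
  have "card (I - col ` arcs B) \<ge> card I - card (col ` arcs B)"
    using finite_arcs_rainbow_from[OF B] by (intro diff_card_le_card_Diff) auto
  moreover have "card (col ` arcs B) = k"
    using B arcs by (simp add: rainbow_from_def card_image)
  ultimately have "card (verts B) \<le> card (I - col ` arcs B)"
    using Suc.prems assms(3) card by simp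
  moreover have "verts B \<noteq> verts G" using card Suc.prems by auto
  ultimately show ?case using rainbow_from_extend[OF B] card by simp
qed

end

theorem theorem4p3:
  fixes G :: "('a,'b) pre_digraph"
    and A :: "nat \<Rightarrow> ('a,'b) pre_digraph"
    and V :: "'a set"
    and n k :: nat
  assumes "finite V" and "card V = n" and "n \<ge> 2"
    and "verts G = V"
    and "disjoint_union_of_spanning_arborescences G {1..n - 1} A"
    and "1 \<le> k" and "k \<le> n div 2"
  shows "\<exists>B. subgraph B G \<and> arborescence B \<and> rainbow {1..n - 1} A B \<and> card (arcs B) = k"
proof -
  let ?I = "{1..n - 1}"
  have span: "spanning (A i) G" and arb: "arborescence (A i)" if "i \<in> ?I" for i
    using assms(5) that by (auto simp: disjoint_union_of_spanning_arborescences_def)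
  have disj: "disjoint_family_on (\<lambda>i. arcs (A i)) ?I"
    using assms(5) by (simp add: disjoint_union_of_spanning_arborescences_def)
  define root where "root i = (SOME r. arborescence_from (A i) r)" for i
  have root: "arborescence_from (A i) (root i)" if i: "i \<in> ?I" for i
    unfolding root_def by (rule arborescence_imp_arborescence_from[OF arb[OF i]]) (rule someI)
  \<comment> \<open>Disjointness of the arc sets makes the index unique, so the description is well
    defined on every arc of \<open>G\<close>.\<close>
  define col where "col e = (THE i. i \<in> ?I \<and> e \<in> arcs (A i))" for e
  have col: "col e = i" if "i \<in> ?I" "e \<in> arcs (A i)" for i e
    unfolding col_def
  proof (rule the_equality)
    show "i \<in> ?I \<and> e \<in> arcs (A i)" using that by blast
    show "j = i" if "j \<in> ?I \<and> e \<in> arcs (A j)" for j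
      using that \<open>i \<in> ?I\<close> \<open>e \<in> arcs (A i)\<close> disj unfolding disjoint_family_on_def by blast
  qed
  have "1 \<in> ?I" using assms(3) by simp
  from span[OF this] have "wf_digraph G" by (simp add: spanning_def subgraph_def)
  then interpret wf_digraph G .
  interpret arborescence_packing G ?I A root col
  proof
    show "finite (verts G)" "finite ?I" using assms(1,4) by simp_all
  qed (fact span root col)+
  have "\<exists>B r. rainbow_from B r \<and> card (verts B) = Suc k"
  proof (rule rainbow_from_exists)
    show "verts G \<noteq> {}" "2 * k \<le> card (verts G)" "card (verts G) \<le> Suc (card ?I)"
      using assms(2,3,4,7) by auto
  qed
  then obtain B r where B: "rainbow_from B r" "card (verts B) = Suc k" by blast
  have "card (arcs B) = k"
    using card_arcs_arborescence_from[of B r] B finite_arcs_rainbow_from[OF B(1)]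
    by (simp add: rainbow_from_def)
  moreover have "rainbow ?I A B"
    unfolding rainbow_def
  proof (intro ballI conjI)
    fix i assume i: "i \<in> ?I"
    show fin: "finite (arcs B \<inter> arcs (A i))" using finite_arcs_rainbow_from[OF B(1)] by simp
    \<comment> \<open>Both arcs have colour \<open>i\<close>, so injectivity of \<open>col\<close>
      on \<open>arcs B\<close> identifies them.\<close>
    have "e = f" if "e \<in> arcs B \<inter> arcs (A i)" "f \<in> arcs B \<inter> arcs (A i)" for e f
      using that col[OF i] B(1) by (auto simp: rainbow_from_def inj_on_def)
    with fin show "card (arcs B \<inter> arcs (A i)) \<le> 1" by (simp add: card_le_Suc0_iff_eq)
  qed
  moreover have "subgraph B G" "arborescence_from B r"
    using B(1) by (simp_all add: rainbow_from_def)
  ultimately show ?thesis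
    using arborescence_from_imp_arborescence[of B r] by (intro exI[of _ B]) simp
qed

end
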